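(* There exists an absolute constant $c>0$ such that for every squarefree integer $m\geq 2$ and every set $A\subset\mathbb{Z}_m$ such that $A-A$ does not contain non-zero squares, $$|A|\leq m\,e^{-c\log m/\log\log m}.$$
   Context: $\mathbb{Z}_m=\mathbb{Z}/m\mathbb{Z}$. An element $x\in\mathbb{Z}_m$ is a square if $x=y^2$ for some $y\in\mathbb{Z}_m$ ($y$ need not be invertible). $A-A=\{a-b: a,b\in A\}$; the condition on $A$ means that $a-b$ is not a square in $\mathbb{Z}_m$ for all distinct $a,b\in A$. Here $\log$ is the natural logarithm. *)

theory Defs
  imports Complex_Main "HOL-Number_Theory.Residues" "HOL-Computational_Algebra.Squarefree"
begin

definition ring_squares :: "('a, 'b) ring_scheme \<Rightarrow> 'a set" where
  "ring_squares R = {x \<in> carrier R. \<exists>y \<in> carrier R. x = y [^]\<^bsub>R\<^esub> (2::nat)}"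

definition difference_set :: "('a, 'b) ring_scheme \<Rightarrow> 'a set \<Rightarrow> 'a set" where
  "difference_set R A = {a \<ominus>\<^bsub>R\<^esub> b | a b. a \<in> A \<and> b \<in> A}"

end

theory Submission
  imports Defs "HOL-Analysis.Infinite_Products" "HOL-Analysis.Complex_Transcendental"
    "HOL-Number_Theory.Euler_Criterion" "HOL-Library.Function_Algebras"
begin

text \<open>
By the Chinese remainder theorem, for squarefree \<open>m\<close> the hypothesis on \<open>A\<close> says that any two distinct
\<open>a, b \<in> A\<close> are separated by some odd prime \<open>p\<close> dividing \<open>m\<close>: the difference \<open>a - b\<close> is a
quadratic non-residue modulo \<open>p\<close>. From here on only this notion (\<open>separated\<close>) and the set \<open>P\<close> of
odd prime divisors of \<open>m\<close>, with \<open>n\<close> elements, matter.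

For \<open>p \<in> P\<close> and a complex parameter \<open>t\<close> consider the function
\<open>h(x) = 1 + \<chi>(x) + t [p dvd x]\<close> on the residues modulo \<open>p\<close>, where \<open>\<chi>\<close> is the Legendre symbol. It
vanishes at the non-residues, so the product \<open>F\<close> of these functions over \<open>p \<in> P\<close>
satisfies \<open>F(a - b) = 0\<close> for distinct \<open>a, b \<in> A\<close>. On the other hand the Fourier coefficients of
\<open>h\<close> are explicit: the \<open>r\<close>-th one is \<open>(t + \<chi>(r) G) / p\<close> for \<open>r \<noteq> 0\<close> and \<open>1 + t / p\<close> for
\<open>r = 0\<close>, with the Gauss sum \<open>G\<close> of modulus \<open>sqrt p\<close>. Two choices of \<open>t\<close> give two bounds.

\<^item> With \<open>t = -G\<close> the coefficients at all quadratic residues \<open>r\<close> vanish. The matrix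
  \<open>F(a - b)\<close> then has rank at most the product of the \<open>(p + 1) / 2 \<le> 2 p / 3\<close>, but on \<open>A\<close> it is
  a nonzero multiple of the identity matrix. Hence \<open>|A| \<le> (2/3)^n m\<close>
  (\<open>card_separated_le_power\<close>).

\<^item> With \<open>t = 2 n sqrt p\<close> each coefficient is a nonnegative real times a number within \<open>1 / (2 n)\<close>
  of \<open>1\<close>, so that products of \<open>n\<close> of them still have nonnegative real part. In the Fourier
  expansion of the sum of \<open>F(a - b)\<close> over \<open>a, b \<in> A\<close> one may therefore keep the trivial frequency alone,
  as in Delsarte's linear programming bound. Hence \<open>|A| \<le> (3 n)^n sqrt m\<close>
  (\<open>card_separated_le_spectral\<close>).

The first bound suffices if \<open>n\<close> is at least a small constant times \<open>log m / log log m\<close>. Otherwise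
\<open>(3 n)^n\<close> is a small power of \<open>m\<close>, and the second bound saves a power of \<open>m\<close>
(\<open>card_separated_le\<close>).
\<close>

section \<open>Additive characters and the Legendre symbol modulo a prime\<close>

definition add_char :: "nat \<Rightarrow> nat \<Rightarrow> int \<Rightarrow> complex" where
  "add_char p r x = cis (2 * pi * real r * real_of_int x / real p)"

lemma add_char_0 [simp]: "add_char p 0 x = 1"
  by (simp add: add_char_def)

lemma add_char_diff: "add_char p r (x - y) = add_char p r x * cnj (add_char p r y)"
  by (simp add: add_char_def cis_cnj cis_mult ring_distribs diff_divide_distrib)

lemma add_char_cong:
  assumes "p > 0" "[x = y] (mod int p)"
  shows "add_char p r x = add_char p r y"
proof -
  obtain k where k: "x = y + int p * k"
    using assms(2) by (metis cong_iff_lin cong_sym)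
  have "2 * pi * real r * real_of_int x / real p
        = 2 * pi * real r * real_of_int y / real p + 2 * pi * real_of_int (int r * k)"
    using assms(1) by (simp add: k field_simps)
  then show ?thesis
    by (simp add: add_char_def flip: cis_mult)
qed

lemma add_char_mult: "add_char p (r * s) x = add_char p r (int s * x)"
  by (simp add: add_char_def mult_ac)

lemma sum_add_char:
  assumes "p > 0"
  shows "(\<Sum>r<p. add_char p r x) = (if int p dvd x then of_nat p else 0)"
proof -
  define w where "w = add_char p 1 x"
  have pow: "add_char p r x = w ^ r" for r
  proof -
    have "w ^ r = cis (real r * (2 * pi * real 1 * real_of_int x / real p))"
      by (simp only: w_def add_char_def Complex.DeMoivre)
    also have "real r * (2 * pi * real 1 * real_of_int x / real p)
        = 2 * pi * real r * real_of_int x / real p" by simp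
    finally show ?thesis by (simp only: add_char_def)
  qed
  have w1: "w = 1 \<longleftrightarrow> int p dvd x"
  proof
    assume "w = 1"
    then obtain k where "2 * pi * real_of_int x / real p = of_int k * (2 * pi)"
      unfolding w_def add_char_def
      by (auto simp: complex_eq_iff cos_one_2pi_int mult_ac)
    then have "real_of_int x = real_of_int (int p * k)"
      using assms by (simp add: field_simps)
    then show "int p dvd x" by (metis dvd_triv_left of_int_eq_iff)
  next
    assume "int p dvd x"
    then have "[x = 0] (mod int p)" by (simp add: cong_0_iff)
    from add_char_cong[OF assms this, of 1] show "w = 1"
      by (simp add: w_def) (simp add: add_char_def)
  qed
  have "w ^ p = add_char p p x" by (simp add: pow)
  also have "\<dots> = cis (2 * pi * real_of_int x)"
    unfolding add_char_def using assms by (intro arg_cong[of _ _ cis]) simp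
  finally have "w ^ p = 1" by (simp only: cis_multiple_2pi Ints_of_int)
  then show ?thesis
    using w1 by (auto simp: pow geometric_sum)
qed

locale odd_prime =
  fixes p :: nat
  assumes prime: "prime p" and gt_2: "p > 2"
begin

definition chi :: "int \<Rightarrow> complex" where
  "chi x = of_int (Legendre x (int p))"

lemma pos: "p > 0" using gt_2 by simp

lemma chi_cases: "chi x \<in> {-1, 0, 1}"
  by (auto simp: chi_def Legendre_def)

lemma cnj_chi [simp]: "cnj (chi x) = chi x"
  by (simp add: chi_def)

lemma chi_eq_0_iff: "chi x = 0 \<longleftrightarrow> int p dvd x"
  by (auto simp: chi_def Legendre_def cong_0_iff)

lemma chi_sq: "chi x * chi x = (if int p dvd x then 0 else 1)"
  by (auto simp: chi_def Legendre_def cong_0_iff)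

lemma chi_cong: "[x = y] (mod int p) \<Longrightarrow> chi x = chi y"
  by (auto simp: chi_def Legendre_def QuadRes_def dest: cong_trans cong_sym)

lemma chi_mult: "chi (x * y) = chi x * chi y"
proof (cases "int p dvd x \<or> int p dvd y")
  case True
  then have "int p dvd x * y" by auto
  with True show ?thesis by (metis chi_eq_0_iff mult_eq_0_iff)
next
  case False
  then have nd: "\<not> int p dvd x * y"
    using prime prime_dvd_mult_iff[of "int p" x y] by auto
  have "[Legendre (x * y) (int p) = (x * y) ^ ((p - 1) div 2)] (mod int p)"
    using euler_criterion[OF prime gt_2] by blast
  moreover have "[Legendre x (int p) * Legendre y (int p)
      = x ^ ((p - 1) div 2) * y ^ ((p - 1) div 2)] (mod int p)"
    using euler_criterion[OF prime gt_2] by (intro cong_mult) blast+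
  ultimately have "[Legendre (x * y) (int p) = Legendre x (int p) * Legendre y (int p)] (mod int p)"
    by (metis cong_sym cong_trans power_mult_distrib)
  then have "int p dvd Legendre (x * y) (int p) - Legendre x (int p) * Legendre y (int p)"
    by (simp add: cong_iff_dvd_diff)
  moreover have "\<bar>Legendre (x * y) (int p) - Legendre x (int p) * Legendre y (int p)\<bar> < int p"
    using gt_2 by (auto simp: Legendre_def)
  ultimately have "Legendre (x * y) (int p) = Legendre x (int p) * Legendre y (int p)"
    by (metis dvd_imp_le_int abs_of_nat not_less right_minus_eq)
  then show ?thesis by (simp add: chi_def)
qed

text \<open>Multiplication by a unit permutes the residues; stated for sums over the representatives
\<open>0, \<dots>, p - 1\<close> of a function on the integers with period \<open>p\<close>.\<close>

lemma sum_mod_reindex: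
  fixes f :: "int \<Rightarrow> complex"
  assumes f: "\<And>x y. [x = y] (mod int p) \<Longrightarrow> f x = f y" and r: "\<not> p dvd r"
  shows "(\<Sum>y<p. f (int r * int y)) = (\<Sum>y<p. f (int y))"
proof -
  have inj: "inj_on (\<lambda>y. (r * y) mod p) {..<p}"
  proof (rule inj_onI)
    fix x y assume xy: "x \<in> {..<p}" "y \<in> {..<p}" and "r * x mod p = r * y mod p"
    moreover have "coprime r p"
      using r prime by (simp add: coprime_commute prime_imp_coprime)
    ultimately have "[x = y] (mod p)" by (metis cong_def cong_mult_lcancel_nat)
    with xy show "x = y" by (simp add: cong_def)
  qed
  have img: "(\<lambda>y. (r * y) mod p) ` {..<p} = {..<p}"
    using inj pos by (intro endo_inj_surj) auto
  have "(\<Sum>y<p. f (int y)) = (\<Sum>y<p. f (int (r * y mod p)))"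
    using sum.reindex[OF inj, of "\<lambda>y. f (int y)"] by (simp add: img)
  also have "\<dots> = (\<Sum>y<p. f (int r * int y))"
    by (intro sum.cong refl f) (simp add: cong_def zmod_int)
  finally show ?thesis by simp
qed

text \<open>Squaring identifies \<open>1\<close> with \<open>p - 1\<close>, so it is not injective on the residues and therefore not
surjective.\<close>

lemma ex_nonresidue: "\<exists>r<p. chi (int r) = -1"
proof (rule ccontr)
  assume "\<not> ?thesis"
  then have sq: "\<exists>y. [y\<^sup>2 = int r] (mod int p)" if "r < p" for r
  proof (cases "int p dvd int r")
    case True
    then have "[0\<^sup>2 = int r] (mod int p)" by (metis cong_0_iff cong_sym zero_power2)
    then show ?thesis by blast
  next
    case False
    then show ?thesis using \<open>\<not> (\<exists>r<p. chi (int r) = -1)\<close> that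
      by (auto simp: chi_def Legendre_def QuadRes_def cong_0_iff split: if_splits)
  qed
  let ?s = "\<lambda>y. y ^ 2 mod p"
  have "{..<p} \<subseteq> ?s ` {..<p}"
  proof
    fix r assume "r \<in> {..<p}"
    then obtain y where y: "[y\<^sup>2 = int r] (mod int p)" using sq by auto
    define z where "z = nat (y mod int p)"
    have z: "int z = y mod int p" "z < p"
      using pos by (auto simp: z_def nat_less_iff)
    have "int (z ^ 2 mod p) = int r"
      using y \<open>r \<in> {..<p}\<close> by (simp add: zmod_int z power_mod cong_def)
    then show "r \<in> ?s ` {..<p}" using z(2) by (auto intro!: image_eqI[of _ _ z])
  qed
  moreover have "?s ` {..<p} \<subseteq> {..<p}" using pos by auto
  ultimately have "inj_on ?s {..<p}" by (intro eq_card_imp_inj_on) auto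
  moreover have "?s 1 = ?s (p - 1)"
  proof -
    have "int ((p - 1)\<^sup>2 mod p) = (int p - 1)\<^sup>2 mod int p"
      using pos by (simp add: zmod_int of_nat_diff)
    also have "(int p - 1)\<^sup>2 = 1 + int p * (int p - 2)"
      by (simp add: power2_eq_square algebra_simps)
    also have "\<dots> mod int p = int (1 mod p)" by (simp only: mod_mult_self2 of_nat_1 zmod_int)
    finally show ?thesis by (simp only: of_nat_eq_iff power_one)
  qed
  ultimately have "1 = p - 1"
    by (rule inj_onD) (use gt_2 in auto)
  then show False using gt_2 by simp
qed

text \<open>Scaling the summation variable by a non-residue permutes the terms, but also changes the sign of
each of them.\<close>

lemma sum_chi: "(\<Sum>y<p. chi (int y)) = 0"
proof -
  obtain r where r: "r < p" "chi (int r) = -1" using ex_nonresidue by blast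
  then have "\<not> p dvd r" using chi_eq_0_iff[of "int r"] by auto
  from sum_mod_reindex[where f = chi, OF chi_cong this] have "chi (int r) * (\<Sum>y<p. chi (int y)) = (\<Sum>y<p. chi (int y))"
    by (simp add: chi_mult sum_distrib_left)
  then show ?thesis using r by simp
qed

lemma card_residues: "2 * card {r\<in>{..<p}. chi (int r) = 1} = p - 1"
proof -
  let ?Q = "{r\<in>{..<p}. chi (int r) = 1}" and ?N = "{r\<in>{..<p}. chi (int r) = -1}"
  have split: "{..<p} = {0} \<union> ?Q \<union> ?N"
  proof -
    have "r = 0" if "r < p" "chi (int r) = 0" for r
      using that by (auto simp: chi_eq_0_iff dest: dvd_imp_le)
    then show ?thesis using chi_cases pos by fastforce
  qed
  have c0: "chi 0 = 0" by (simp add: chi_eq_0_iff)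
  have "(\<Sum>y\<in>{0} \<union> ?Q \<union> ?N. chi (int y)) = of_nat (card ?Q) - of_nat (card ?N)"
    by (subst sum.union_disjoint, auto simp: c0)+
  then have "of_nat (card ?Q) - of_nat (card ?N) = (0::complex)"
    by (metis sum_chi split)
  then have "card ?Q = card ?N" by simp
  moreover have "p = 1 + card ?Q + card ?N"
  proof -
    have "p = card ({0} \<union> ?Q \<union> ?N)" using split by (metis card_lessThan)
    also have "\<dots> = 1 + card ?Q + card ?N"
      by (subst card_Un_disjoint, auto simp: c0)+
    finally show ?thesis .
  qed
  ultimately show ?thesis by linarith
qed

section \<open>Gauss sums\<close>

definition gauss_sum :: "nat \<Rightarrow> complex" where
  "gauss_sum r = (\<Sum>y<p. chi (int y) * cnj (add_char p r (int y)))"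

text \<open>All Gauss sums reduce to a single one: for \<open>r\<close> coprime to \<open>p\<close> substitute \<open>r y\<close> for the summation
variable.\<close>

lemma gauss_sum_eq: "r < p \<Longrightarrow> gauss_sum r = chi (int r) * gauss_sum 1"
proof (cases "r = 0")
  case True
  then show ?thesis using sum_chi by (simp add: gauss_sum_def chi_eq_0_iff)
next
  case False
  assume "r < p"
  with False have nd: "\<not> p dvd r" by (auto dest: dvd_imp_le)
  have "(\<Sum>y<p. chi (int y) * cnj (add_char p 1 (int y)))
      = (\<Sum>y<p. chi (int r * int y) * cnj (add_char p 1 (int r * int y)))"
    by (rule sum_mod_reindex[where f = "\<lambda>y. chi y * cnj (add_char p 1 y)", symmetric, OF _ nd])
       (metis add_char_cong chi_cong pos)
  then have "gauss_sum 1 = chi (int r) * gauss_sum r"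
    using add_char_mult[of p 1 r] by (simp add: gauss_sum_def chi_mult sum_distrib_left mult_ac)
  moreover have "chi (int r) * chi (int r) = 1" using nd by (simp add: chi_sq)
  ultimately show ?thesis by (metis mult.assoc mult_1)
qed

lemma fourier_chi: "(\<Sum>r<p. gauss_sum r * add_char p r x) = of_nat p * chi x"
proof -
  define z where "z = nat (x mod int p)"
  have z: "int z = x mod int p" "z < p" using pos by (auto simp: z_def nat_less_iff)
  have eq: "int p dvd x - int y \<longleftrightarrow> y = z" if "y < p" for y
  proof -
    have "int p dvd x - int y \<longleftrightarrow> x mod int p = int y mod int p"
      by (simp add: mod_eq_dvd_iff)
    then show ?thesis using that by (auto simp flip: z(1))
  qed
  have "(\<Sum>r<p. gauss_sum r * add_char p r x)
      = (\<Sum>r<p. \<Sum>y<p. chi (int y) * add_char p r (x - int y))"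
    unfolding gauss_sum_def sum_distrib_right by (simp add: add_char_diff mult_ac)
  also have "\<dots> = (\<Sum>y<p. chi (int y) * (\<Sum>r<p. add_char p r (x - int y)))"
    by (subst sum.swap) (simp add: sum_distrib_left)
  also have "\<dots> = (\<Sum>y<p. if y = z then of_nat p * chi (int y) else 0)"
    by (intro sum.cong refl) (auto simp: sum_add_char[OF pos] eq)
  also have "\<dots> = of_nat p * chi (int z)" using z by simp
  also have "chi (int z) = chi x" using z by (intro chi_cong) (simp add: cong_def)
  finally show ?thesis .
qed

text \<open>Parseval: by the previous reduction the \<open>p - 1\<close> nontrivial Gauss sums have the same modulus, and
their squared moduli add up to \<open>p\<close> times the number \<open>p - 1\<close> of nonzero values of \<open>chi\<close>.\<close>

lemma norm_gauss_sum: "norm (gauss_sum 1) = sqrt (real p)"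
proof -
  have one: "(\<Sum>y<p. chi (int y) * chi (int y)) = of_nat (p - 1)"
  proof -
    have "(\<Sum>y<p. chi (int y) * chi (int y)) = (\<Sum>y\<in>{..<p} - {0}. 1)"
      using pos by (intro sum.mono_neutral_cong_right) (auto simp: chi_sq dest: dvd_imp_le)
    then show ?thesis using pos by simp
  qed
  have "of_nat (p - 1) * (gauss_sum 1 * cnj (gauss_sum 1)) =
      (\<Sum>r<p. (chi (int r) * chi (int r)) * (gauss_sum 1 * cnj (gauss_sum 1)))"
    by (simp add: one flip: sum_distrib_right)
  also have "\<dots> = (\<Sum>r<p. gauss_sum r * cnj (gauss_sum r))"
    by (intro sum.cong refl) (simp add: gauss_sum_eq)
  also have "\<dots> = (\<Sum>r<p. \<Sum>y<p. gauss_sum r * (chi (int y) * add_char p r (int y)))"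
    by (simp add: gauss_sum_def sum_distrib_left)
  also have "\<dots> = (\<Sum>y<p. chi (int y) * (\<Sum>r<p. gauss_sum r * add_char p r (int y)))"
    by (subst sum.swap) (simp add: sum_distrib_left mult_ac)
  also have "\<dots> = of_nat p * of_nat (p - 1)"
    unfolding fourier_chi one[symmetric] by (simp add: sum_distrib_left mult_ac)
  finally have "gauss_sum 1 * cnj (gauss_sum 1) = of_nat p"
    using gt_2 by simp
  then have "complex_of_real (norm (gauss_sum 1) ^ 2) = complex_of_real (real p)"
    by (metis complex_norm_square of_real_of_nat_eq of_real_power)
  then have "norm (gauss_sum 1) ^ 2 = real p" by (simp only: of_real_eq_iff)
  then show ?thesis by (metis norm_ge_zero real_sqrt_unique)
qed

section \<open>A function vanishing at the non-residues\<close>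

text \<open>The parameter \<open>t\<close> is the height of an extra peak at \<open>0\<close>. It leaves the zeros at the non-residues
alone and shifts all Fourier coefficients by the same amount, which is what makes them adjustable.\<close>

definition peak :: "complex \<Rightarrow> int \<Rightarrow> complex" where
  "peak t x = 1 + chi x + (if int p dvd x then t else 0)"

definition peak_coeff :: "complex \<Rightarrow> nat \<Rightarrow> complex" where
  "peak_coeff t r = (if r = 0 then 1 else 0) + (t + gauss_sum r) / of_nat p"

lemma peak_0: "peak t 0 = 1 + t"
  using chi_eq_0_iff[of 0] by (simp add: peak_def)

lemma peak_nonresidue: "Legendre x (int p) = -1 \<Longrightarrow> peak t x = 0"
  using chi_eq_0_iff[of x] by (simp add: peak_def chi_def)

lemma peak_expansion: "peak t x = (\<Sum>r<p. peak_coeff t r * add_char p r x)"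
proof -
  have "(\<Sum>r<p. peak_coeff t r * add_char p r x)
      = (\<Sum>r<p. if r = 0 then add_char p r x else 0)
        + t / of_nat p * (\<Sum>r<p. add_char p r x)
        + (\<Sum>r<p. gauss_sum r * add_char p r x) / of_nat p"
    unfolding sum_distrib_left sum_divide_distrib sum.distrib[symmetric]
    by (intro sum.cong refl) (simp add: peak_coeff_def algebra_simps add_divide_distrib)
  also have "(\<Sum>r<p. if r = 0 then add_char p r x else 0) = 1"
    using pos by (subst sum.delta) auto
  finally show ?thesis
    using pos unfolding fourier_chi sum_add_char[OF pos] by (simp add: peak_def)
qed

text \<open>The coefficient at \<open>r\<close> is proportional to \<open>chi r - 1\<close> for this choice of \<open>t\<close>, apart from \<open>r = 0\<close>, so half of
the nonzero frequencies drop out.\<close>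

lemma card_peak_coeff_support:
  "card {r\<in>{..<p}. peak_coeff (- gauss_sum 1) r \<noteq> 0} \<le> (p + 1) div 2"
proof -
  let ?Q = "{r\<in>{..<p}. chi (int r) = 1}"
  have "peak_coeff (- gauss_sum 1) r = 0" if "r \<in> ?Q" for r
    using that gauss_sum_eq[of r] chi_eq_0_iff[of 0]
    by (cases "r = 0") (auto simp: peak_coeff_def)
  then have "card {r\<in>{..<p}. peak_coeff (- gauss_sum 1) r \<noteq> 0} \<le> card ({..<p} - ?Q)"
    by (intro card_mono) auto
  also have "\<dots> = p - card ?Q"
    by (subst card_Diff_subset) auto
  finally show ?thesis using card_residues by linarith
qed

lemma peak_at_0_nonzero: "peak (- gauss_sum 1) 0 \<noteq> 0"
proof
  assume "peak (- gauss_sum 1) 0 = 0"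
  then have "gauss_sum 1 = 1" by (simp add: peak_0)
  then have "sqrt (real p) = 1" using norm_gauss_sum by simp
  then show False using gt_2 by simp
qed

text \<open>The shift of the coefficients by \<open>T / p\<close> competes with the contribution of the Gauss sum; \<open>z\<close>
measures the relative size of the latter, which is small once \<open>T\<close> is large compared with \<open>sqrt p\<close>.\<close>

lemma peak_coeff_factor:
  assumes T: "T > 0" and r: "r < p"
  shows "\<exists>s z. s \<ge> 0 \<and> norm z \<le> sqrt (real p) / T \<and>
           peak_coeff (of_real T) r = of_real s * (1 + z)"
proof (cases "r = 0")
  case True
  have "gauss_sum 0 = 0" using sum_chi by (simp add: gauss_sum_def)
  then have "peak_coeff (of_real T) r = of_real (1 + T / real p) * (1 + 0)"
    using True by (simp add: peak_coeff_def)
  then show ?thesis using T by (intro exI[of _ "1 + T / real p"] exI[of _ 0]) auto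
next
  case False
  have "norm (chi (int r)) \<le> 1" using chi_cases[of "int r"] by auto
  then have "norm (gauss_sum r) \<le> sqrt (real p)"
    using mult_right_mono[of "norm (chi (int r))" 1 "sqrt (real p)"]
    by (simp only: gauss_sum_eq[OF r] norm_mult norm_gauss_sum) simp
  then have "norm (gauss_sum r / of_real T) \<le> sqrt (real p) / T"
    using T by (simp add: norm_divide divide_right_mono)
  moreover have "peak_coeff (of_real T) r = of_real (T / real p) * (1 + gauss_sum r / of_real T)"
    using False T pos by (simp add: peak_coeff_def field_simps)
  ultimately show ?thesis
    using T by (intro exI[of _ "T / real p"] exI[of _ "gauss_sum r / of_real T"]) auto
qed

end

section \<open>The rank of a factorized matrix\<close>

text \<open>A nonzero scalar matrix indexed by \<open>A\<close> that factors through \<open>R\<close> has full rank, at most the size of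
\<open>R\<close>. Concretely, the rows \<open>g _ a\<close> of the left factor are linearly independent, because pairing
a linear combination of them with \<open>h _ b\<close> isolates the coefficient of \<open>b\<close>; and they live in the space
of functions supported on \<open>R\<close>.\<close>

lemma card_le_of_diagonal_factorization:
  fixes g h :: "'r \<Rightarrow> 'a \<Rightarrow> complex"
  assumes A: "finite A" and R: "finite R"
    and d: "d \<noteq> 0"
    and fac: "\<And>a b. a \<in> A \<Longrightarrow> b \<in> A \<Longrightarrow> (\<Sum>r\<in>R. g r a * h r b) = (if a = b then d else 0)"
  shows "card A \<le> card R"
proof -
  interpret V: vector_space "\<lambda>(c::complex) (f::'r \<Rightarrow> complex) r. c * f r"
    by standard (auto simp: fun_eq_iff algebra_simps)
  define row where "row a = (\<lambda>r. if r \<in> R then g r a else 0)" for a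
  define unit where "unit s = (\<lambda>r::'r. if r = s then 1 else 0 :: complex)" for s
  have fac': "(\<Sum>r\<in>R. row a r * h r b) = (if a = b then d else 0)" if "a \<in> A" "b \<in> A" for a b
    using fac[OF that] by (simp add: row_def)
  have inj: "inj_on row A"
  proof (rule inj_onI)
    fix a b assume ab: "a \<in> A" "b \<in> A" "row a = row b"
    then have "(if a = b then d else 0) = (if b = b then d else 0)"
      using fac'[of a b] fac'[of b b] by simp
    then show "a = b" using d by (auto split: if_splits)
  qed
  have sum_apply: "(\<Sum>x\<in>X. F x) r = (\<Sum>x\<in>X. F x r)" for F :: "'z \<Rightarrow> 'r \<Rightarrow> complex" and X r
    by (induction X rule: infinite_finite_induct) auto
  have "V.independent (row ` A)"
  proof (rule V.independent_if_scalars_zero)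
    show "finite (row ` A)" using A by simp
    fix f v assume 0: "(\<Sum>v\<in>row ` A. (\<lambda>r. f v * v r)) = 0" and "v \<in> row ` A"
    then obtain b where b: "b \<in> A" "v = row b" by blast
    have "(\<Sum>a\<in>A. f (row a) * row a r) = 0" for r
      using fun_cong[OF 0, of r] inj by (simp add: sum_apply sum.reindex)
    then have "0 = (\<Sum>r\<in>R. (\<Sum>a\<in>A. f (row a) * row a r) * h r b)" by simp
    also have "\<dots> = (\<Sum>a\<in>A. f (row a) * (\<Sum>r\<in>R. row a r * h r b))"
      unfolding sum_distrib_left sum_distrib_right by (subst sum.swap) (simp add: mult_ac)
    also have "\<dots> = (\<Sum>a\<in>A. if a = b then f (row b) * d else 0)"
      using b by (intro sum.cong refl) (simp add: fac')
    also have "\<dots> = f v * d" using b A by simp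
    finally show "f v = 0" using d by simp
  qed
  moreover have "row ` A \<subseteq> V.span (unit ` R)"
  proof
    fix v assume "v \<in> row ` A"
    then obtain a where v: "v = row a" by blast
    have "v = (\<Sum>s\<in>R. (\<lambda>r. g s a * unit s r))"
    proof (rule ext)
      fix r
      have "(\<Sum>s\<in>R. g s a * unit s r) = (\<Sum>s\<in>R. if s = r then g s a else 0)"
        by (intro sum.cong refl) (auto simp: unit_def)
      then show "v r = (\<Sum>s\<in>R. (\<lambda>r. g s a * unit s r)) r"
        using R by (simp add: v row_def sum_apply)
    qed
    also have "\<dots> \<in> V.span (unit ` R)"
      by (intro V.span_sum V.span_scale V.span_base) auto
    finally show "v \<in> V.span (unit ` R)" .
  qed
  ultimately have "card (row ` A) \<le> card (unit ` R)"
    using V.independent_span_bound[of "unit ` R" "row ` A"] R by simp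
  then show ?thesis
    using card_image[OF inj] card_image_le[OF R, of unit] by linarith
qed

section \<open>Separated sets and the product kernel\<close>

definition separated :: "nat set \<Rightarrow> int set \<Rightarrow> bool" where
  "separated P A \<longleftrightarrow> (\<forall>a\<in>A. \<forall>b\<in>A. a \<noteq> b \<longrightarrow> (\<exists>p\<in>P. Legendre (a - b) (int p) = -1))"

locale odd_primes =
  fixes P :: "nat set"
  assumes finite_P: "finite P" and odd_prime_P: "p \<in> P \<Longrightarrow> odd_prime p"
begin

definition kernel :: "(nat \<Rightarrow> complex) \<Rightarrow> int \<Rightarrow> complex" where
  "kernel t x = (\<Prod>p\<in>P. odd_prime.peak p (t p) x)"

text \<open>Only the frequencies with nonzero coefficient are kept, since their number bounds the
rank of the kernel.\<close>

definition frequencies :: "(nat \<Rightarrow> complex) \<Rightarrow> (nat \<Rightarrow> nat) set" where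
  "frequencies t = PiE P (\<lambda>p. {r\<in>{..<p}. odd_prime.peak_coeff p (t p) r \<noteq> 0})"

definition coeff :: "(nat \<Rightarrow> complex) \<Rightarrow> (nat \<Rightarrow> nat) \<Rightarrow> complex" where
  "coeff t \<phi> = (\<Prod>p\<in>P. odd_prime.peak_coeff p (t p) (\<phi> p))"

definition character :: "(nat \<Rightarrow> nat) \<Rightarrow> int \<Rightarrow> complex" where
  "character \<phi> x = (\<Prod>p\<in>P. add_char p (\<phi> p) x)"

lemma finite_frequencies: "finite (frequencies t)"
  unfolding frequencies_def using finite_P by (intro finite_PiE) auto

text \<open>The expansions modulo the individual primes multiply out. Splitting the characters at \<open>x - y\<close> exhibits the
kernel as a matrix product over the frequencies.\<close>

lemma kernel_expansion:
  "kernel t (x - y) = (\<Sum>\<phi>\<in>frequencies t. coeff t \<phi> * character \<phi> x * cnj (character \<phi> y))"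
proof -
  have "kernel t (x - y) = (\<Prod>p\<in>P. \<Sum>r\<in>{r\<in>{..<p}. odd_prime.peak_coeff p (t p) r \<noteq> 0}.
           odd_prime.peak_coeff p (t p) r * add_char p r (x - y))"
    unfolding kernel_def
  proof (rule prod.cong[OF refl])
    fix p assume "p \<in> P"
    then interpret odd_prime p by (rule odd_prime_P)
    show "peak (t p) (x - y) = (\<Sum>r\<in>{r\<in>{..<p}. peak_coeff (t p) r \<noteq> 0}.
           peak_coeff (t p) r * add_char p r (x - y))"
      unfolding peak_expansion by (rule sum.mono_neutral_right) auto
  qed
  also have "\<dots> = (\<Sum>\<phi>\<in>frequencies t. \<Prod>p\<in>P.
           odd_prime.peak_coeff p (t p) (\<phi> p) * add_char p (\<phi> p) (x - y))"
    unfolding frequencies_def using finite_P by (intro prod_sum_PiE) auto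
  finally show ?thesis
    unfolding coeff_def character_def add_char_diff prod.distrib cnj_prod
    by (simp only: mult.assoc)
qed

lemma kernel_separated:
  assumes "separated P A" "a \<in> A" "b \<in> A"
  shows "kernel t (a - b) = (if a = b then (\<Prod>p\<in>P. 1 + t p) else 0)"
proof (cases "a = b")
  case True
  then show ?thesis
    by (simp add: kernel_def odd_prime.peak_0[OF odd_prime_P])
next
  case False
  then obtain p where p: "p \<in> P" "Legendre (a - b) (int p) = -1"
    using assms unfolding separated_def by blast
  then have "odd_prime.peak p (t p) (a - b) = 0"
    by (intro odd_prime.peak_nonresidue odd_prime_P)
  then have "kernel t (a - b) = 0"
    unfolding kernel_def using p(1) finite_P by (intro prod_zero) auto
  then show ?thesis using False by simp
qed

text \<open>Choosing \<open>t\<close> so that half of the coefficients vanish at each prime makes the rank small, while the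
diagonal entries stay nonzero because the Gauss sum does not have modulus \<open>1\<close>.\<close>

lemma card_separated_le_rank:
  assumes A: "finite A" "separated P A"
  shows "card A \<le> (\<Prod>p\<in>P. (p + 1) div 2)"
proof -
  define t where "t p = - odd_prime.gauss_sum p 1" for p
  have d: "(\<Prod>p\<in>P. 1 + t p) \<noteq> 0"
  proof -
    have "1 + t p \<noteq> 0" if "p \<in> P" for p
      using odd_prime.peak_at_0_nonzero[OF odd_prime_P[OF that]]
      unfolding odd_prime.peak_0[OF odd_prime_P[OF that]] t_def .
    then show ?thesis using finite_P by (simp add: prod_zero_iff)
  qed
  have "card A \<le> card (frequencies t)"
    by (rule card_le_of_diagonal_factorization[OF A(1) finite_frequencies d,
          where g = "\<lambda>\<phi> x. coeff t \<phi> * character \<phi> x" and h = "\<lambda>\<phi> y. cnj (character \<phi> y)"])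
       (simp only: kernel_expansion[symmetric] kernel_separated[OF A(2)])
  also have "\<dots> \<le> (\<Prod>p\<in>P. (p + 1) div 2)"
    unfolding frequencies_def card_PiE[OF finite_P] t_def
    by (intro prod_mono conjI odd_prime.card_peak_coeff_support odd_prime_P) auto
  finally show ?thesis .
qed

text \<open>A product of \<open>n\<close> complex numbers within \<open>1 / (2 n)\<close> of \<open>1\<close> is within \<open>exp (1/2) - 1 \<le> 3/4\<close> of \<open>1\<close>, hence
in the right half-plane; nonnegative scalars preserve this half-plane.\<close>

lemma Re_coeff_nonneg:
  assumes \<phi>: "\<phi> \<in> frequencies (\<lambda>p. of_real (T p))"
    and T: "\<And>p. p \<in> P \<Longrightarrow> T p > 0" "\<And>p. p \<in> P \<Longrightarrow> sqrt (real p) / T p \<le> 1 / (2 * real (card P))"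
  shows "Re (coeff (\<lambda>p. of_real (T p)) \<phi>) \<ge> 0"
proof -
  have "\<forall>p\<in>P. \<exists>s z. s \<ge> 0 \<and> norm z \<le> sqrt (real p) / T p \<and>
          odd_prime.peak_coeff p (of_real (T p)) (\<phi> p) = of_real s * (1 + z)"
    using \<phi> T(1) odd_prime.peak_coeff_factor[OF odd_prime_P]
    by (simp add: frequencies_def PiE_iff)
  then obtain s z where sz: "\<And>p. p \<in> P \<Longrightarrow> s p \<ge> 0"
      "\<And>p. p \<in> P \<Longrightarrow> norm (z p) \<le> sqrt (real p) / T p"
      "\<And>p. p \<in> P \<Longrightarrow> odd_prime.peak_coeff p (of_real (T p)) (\<phi> p) = of_real (s p) * (1 + z p)"
    by metis
  have "(\<Prod>p\<in>P. 1 + norm (z p)) \<le> (\<Prod>p\<in>P. exp (norm (z p)))"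
    by (intro prod_mono) (auto simp: exp_ge_add_one_self add_nonneg_nonneg)
  also have "\<dots> = exp (\<Sum>p\<in>P. norm (z p))" using finite_P by (simp add: exp_sum)
  also have "(\<Sum>p\<in>P. norm (z p)) \<le> real (card P) * (1 / (2 * real (card P)))"
    using sz(2) T(2) by (intro sum_bounded_above order_trans[OF sz(2) T(2)])
  also have "\<dots> \<le> 1 / 2" by simp
  also have "exp (1 / 2 :: real) \<le> 1 + 1 / 2 + (1 / 2)\<^sup>2" by (rule exp_bound) auto
  finally have "(\<Prod>p\<in>P. 1 + norm (z p)) \<le> 7 / 4" by (simp add: power2_eq_square)
  then have "norm ((\<Prod>p\<in>P. 1 + z p) - 1) \<le> 3 / 4"
    using norm_prod_minus1_le_prod_minus1[of z P] by linarith
  then have "\<bar>Re ((\<Prod>p\<in>P. 1 + z p) - 1)\<bar> \<le> 3 / 4"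
    by (rule order_trans[OF abs_Re_le_cmod])
  then have Re: "Re (\<Prod>p\<in>P. 1 + z p) \<ge> 0"
    unfolding minus_complex.sel one_complex.sel by linarith
  have "coeff (\<lambda>p. of_real (T p)) \<phi> = of_real (\<Prod>p\<in>P. s p) * (\<Prod>p\<in>P. 1 + z p)"
    unfolding coeff_def by (simp add: sz(3) prod.distrib)
  then have "Re (coeff (\<lambda>p. of_real (T p)) \<phi>) = (\<Prod>p\<in>P. s p) * Re (\<Prod>p\<in>P. 1 + z p)"
    by (simp del: of_real_prod)
  then show ?thesis using Re sz(1) by (simp add: prod_nonneg)
qed

text \<open>Sum the kernel over all pairs from \<open>A\<close>. The diagonal contributes \<open>card A\<close> times the product of the values
\<open>1 + T p\<close> at \<open>0\<close> and the rest nothing. On the Fourier side the trivial frequency contributes at least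
\<open>(card A)^2\<close> and all others have nonnegative real part.\<close>

lemma card_separated_le_spectral:
  assumes A: "finite A" "separated P A"
  shows "real (card A) \<le> (3 * real (card P)) ^ card P * sqrt (real (\<Prod>P))"
proof -
  define n where "n = real (card P)"
  define T where "T p = 2 * n * sqrt (real p)" for p :: nat
  let ?t = "\<lambda>p. complex_of_real (T p)"
  have n: "n \<ge> 1" if "p \<in> P" for p
    using that finite_P by (auto simp: n_def Suc_le_eq card_gt_0_iff)
  have p1: "sqrt (real p) \<ge> 1" if "p \<in> P" for p
    using odd_prime.gt_2[OF odd_prime_P[OF that]] by simp
  have T0: "T p > 0" if "p \<in> P" for p
    using n[OF that] p1[OF that] by (auto simp: T_def)
  have Tn: "sqrt (real p) / T p \<le> 1 / (2 * real (card P))" if "p \<in> P" for p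
    using n[OF that] p1[OF that] by (simp add: T_def n_def field_simps)
  \<comment> \<open>The trivial frequency; as an extensional function it is undefined outside \<open>P\<close>.\<close>
  define \<phi>0 where "\<phi>0 = (\<lambda>p\<in>P. 0 :: nat)"
  have c0: "odd_prime.peak_coeff p (?t p) 0 = of_real (1 + T p / real p)" if "p \<in> P" for p
  proof -
    interpret odd_prime p using that by (rule odd_prime_P)
    show ?thesis using sum_chi by (simp add: peak_coeff_def gauss_sum_def)
  qed
  have c0_ge: "1 + T p / real p \<ge> 1" if "p \<in> P" for p
    using T0[OF that] by simp
  have \<phi>0: "\<phi>0 \<in> frequencies ?t"
  proof -
    have "odd_prime.peak_coeff p (?t p) 0 \<noteq> 0 \<and> 0 < p" if "p \<in> P" for p
      using c0_ge[OF that] odd_prime.pos[OF odd_prime_P[OF that]]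
      unfolding c0[OF that] of_real_eq_0_iff by auto
    then show ?thesis by (auto simp: frequencies_def \<phi>0_def)
  qed
  have coeff0: "Re (coeff ?t \<phi>0) \<ge> 1"
  proof -
    have "coeff ?t \<phi>0 = of_real (\<Prod>p\<in>P. 1 + T p / real p)"
      unfolding coeff_def of_real_prod by (intro prod.cong refl) (simp add: \<phi>0_def c0)
    moreover have "(\<Prod>p\<in>P. 1 + T p / real p) \<ge> 1"
      using c0_ge by (intro prod_ge_1) auto
    ultimately show ?thesis by (simp only: Re_complex_of_real)
  qed
  have char0: "character \<phi>0 x = 1" for x
    by (simp add: character_def \<phi>0_def)
  let ?S = "\<lambda>\<phi>. \<Sum>a\<in>A. character \<phi> a"
  have "of_nat (card A) * (\<Prod>p\<in>P. 1 + ?t p) = (\<Sum>a\<in>A. \<Sum>b\<in>A. kernel ?t (a - b))"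
    using A(1) by (simp add: kernel_separated[OF A(2)])
  also have "\<dots> = (\<Sum>\<phi>\<in>frequencies ?t. coeff ?t \<phi> * (?S \<phi> * cnj (?S \<phi>)))"
  proof -
    have "(\<Sum>a\<in>A. \<Sum>b\<in>A. kernel ?t (a - b))
        = (\<Sum>a\<in>A. \<Sum>\<phi>\<in>frequencies ?t. \<Sum>b\<in>A. coeff ?t \<phi> * character \<phi> a * cnj (character \<phi> b))"
      unfolding kernel_expansion by (intro sum.cong refl sum.swap)
    also have "\<dots> = (\<Sum>\<phi>\<in>frequencies ?t. \<Sum>a\<in>A. \<Sum>b\<in>A. coeff ?t \<phi> * character \<phi> a * cnj (character \<phi> b))"
      by (rule sum.swap)
    also have "\<dots> = (\<Sum>\<phi>\<in>frequencies ?t. coeff ?t \<phi> * (?S \<phi> * cnj (?S \<phi>)))"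
      unfolding cnj_sum sum_product by (simp only: sum_distrib_left mult.assoc)
    finally show ?thesis .
  qed
  also have "\<dots> = (\<Sum>\<phi>\<in>frequencies ?t. coeff ?t \<phi> * of_real ((norm (?S \<phi>))\<^sup>2))"
    by (simp only: complex_norm_square[symmetric] of_real_power)
  finally have "complex_of_real (real (card A) * (\<Prod>p\<in>P. 1 + T p)) = \<dots>"
    by (simp del: of_real_power)
  then have "Re (complex_of_real (real (card A) * (\<Prod>p\<in>P. 1 + T p)))
      = Re (\<Sum>\<phi>\<in>frequencies ?t. coeff ?t \<phi> * of_real ((norm (?S \<phi>))\<^sup>2))"
    by (rule arg_cong)
  then have "real (card A) * (\<Prod>p\<in>P. 1 + T p)
      = (\<Sum>\<phi>\<in>frequencies ?t. Re (coeff ?t \<phi>) * (norm (?S \<phi>))\<^sup>2)"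
    unfolding Re_complex_of_real Re_sum by (simp del: of_real_power)
  moreover have "Re (coeff ?t \<phi>0) * (norm (?S \<phi>0))\<^sup>2
      \<le> (\<Sum>\<phi>\<in>frequencies ?t. Re (coeff ?t \<phi>) * (norm (?S \<phi>))\<^sup>2)"
    by (rule member_le_sum[OF \<phi>0 _ finite_frequencies])
       (auto intro!: mult_nonneg_nonneg Re_coeff_nonneg T0 Tn)
  moreover have "1 * (real (card A))\<^sup>2 \<le> Re (coeff ?t \<phi>0) * (norm (?S \<phi>0))\<^sup>2"
    using coeff0 by (intro mult_mono) (auto simp: char0)
  ultimately have "(real (card A))\<^sup>2 \<le> real (card A) * (\<Prod>p\<in>P. 1 + T p)" by simp
  then have "real (card A) \<le> (\<Prod>p\<in>P. 1 + T p)"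
  proof (cases "card A = 0")
    case True
    have "0 \<le> (\<Prod>p\<in>P. 1 + T p)" using T0 by (intro prod_nonneg) (auto simp: add_nonneg_nonneg less_imp_le)
    then show ?thesis using True by simp
  next
    case False
    then show ?thesis
      using \<open>(real (card A))\<^sup>2 \<le> real (card A) * (\<Prod>p\<in>P. 1 + T p)\<close>
      by (simp add: power2_eq_square)
  qed
  also have "\<dots> \<le> (\<Prod>p\<in>P. (3 * n) * sqrt (real p))"
  proof (intro prod_mono conjI)
    fix p assume p: "p \<in> P"
    have "1 * 1 \<le> n * sqrt (real p)" using n[OF p] p1[OF p] by (intro mult_mono) auto
    then show "1 + T p \<le> (3 * n) * sqrt (real p)" by (simp add: T_def)
    show "0 \<le> 1 + T p" using T0[OF p] by simp
  qed
  also have "\<dots> = (3 * n) ^ card P * sqrt (real (\<Prod>P))"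
  proof -
    have "(\<Prod>p\<in>P. sqrt (real p)) = sqrt (real (\<Prod>P))"
      by (induction P rule: infinite_finite_induct) (auto simp: real_sqrt_mult)
    then show ?thesis by (simp only: prod.distrib prod_constant power_mult_distrib)
  qed
  finally show ?thesis by (simp add: n_def)
qed

end

section \<open>From square-free difference sets to separated sets\<close>

definition odd_prime_divisors :: "int \<Rightarrow> nat set" where
  "odd_prime_divisors m = {p. prime p \<and> odd p \<and> int p dvd m}"

lemma squarefree_dvdI:
  fixes m z :: "'a :: factorial_semiring"
  assumes "squarefree m" "\<And>p. prime p \<Longrightarrow> p dvd m \<Longrightarrow> p dvd z"
  shows "m dvd z"
proof (cases "z = 0")
  case False
  have m0: "m \<noteq> 0" using assms(1) by auto
  show ?thesis
  proof (rule multiplicity_le_imp_dvd[OF m0])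
    fix p :: 'a assume p: "prime p"
    show "multiplicity p m \<le> multiplicity p z"
    proof (cases "p dvd m")
      case True
      then have "multiplicity p z > 0"
        using assms(2) p False by (auto simp: prime_multiplicity_gt_zero_iff)
      moreover have "multiplicity p m \<le> 1"
        using assms(1) p m0 squarefree_factorial_semiring'' by blast
      ultimately show ?thesis by linarith
    qed (simp add: not_dvd_imp_multiplicity_0)
  qed
qed simp

lemma finite_prime_divisors:
  assumes "(m :: int) > 0"
  shows "finite {p :: nat. prime p \<and> int p dvd m}"
proof (rule finite_subset)
  show "{p :: nat. prime p \<and> int p dvd m} \<subseteq> {..nat m}"
  proof
    fix p assume "p \<in> {p :: nat. prime p \<and> int p dvd m}"
    then have "int p \<le> m" using zdvd_imp_le[OF _ assms] by blast
    then show "p \<in> {..nat m}" by simp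
  qed
qed simp

text \<open>Square roots modulo the prime divisors of \<open>m\<close> are glued by the Chinese remainder theorem. Only odd
primes can obstruct, since modulo \<open>2\<close> every residue is its own square.\<close>

lemma square_mod_squarefree:
  assumes m: "m > 0" "squarefree m"
    and sq: "\<And>p. p \<in> odd_prime_divisors m \<Longrightarrow> Legendre d (int p) \<noteq> -1"
  shows "\<exists>y. [y\<^sup>2 = d] (mod m)"
proof -
  let ?Q = "{p. prime p \<and> int p dvd m}"
  have fin: "finite ?Q" using m(1) by (rule finite_prime_divisors)
  have "\<exists>u::nat. [(int u)\<^sup>2 = d] (mod int p)" if p: "p \<in> ?Q" for p
  proof -
    have "\<exists>y. [y\<^sup>2 = d] (mod int p)"
    proof (cases "p = 2")
      case True
      have "even (d\<^sup>2 - d)" by simp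
      then show ?thesis using True by (auto simp: cong_iff_dvd_diff)
    next
      case False
      then have "odd p" using p prime_odd_nat[of p] prime_ge_2_nat[of p] by force
      then have "Legendre d (int p) \<noteq> -1" using p by (intro sq) (simp add: odd_prime_divisors_def)
      then consider "[d = 0] (mod int p)" | "QuadRes (int p) d"
        by (auto simp: Legendre_def split: if_splits)
      then show ?thesis
      proof cases
        case 1
        then have "[0\<^sup>2 = d] (mod int p)" by (simp add: cong_sym)
        then show ?thesis ..
      qed (auto simp: QuadRes_def)
    qed
    then obtain y where y: "[y\<^sup>2 = d] (mod int p)" ..
    have "[(int (nat (y mod int p)))\<^sup>2 = y\<^sup>2] (mod int p)"
      using p by (intro cong_pow) (auto simp: cong_def prime_gt_0_nat)
    then show ?thesis using y cong_trans by blast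
  qed
  then obtain u :: "nat \<Rightarrow> nat" where u: "\<And>p. p \<in> ?Q \<Longrightarrow> [(int (u p))\<^sup>2 = d] (mod int p)"
    by metis
  have "\<exists>x. \<forall>p\<in>?Q. [x = u p] (mod id p)"
    by (rule chinese_remainder_nat[OF fin]) (simp add: primes_coprime)
  then obtain x where x: "\<And>p. p \<in> ?Q \<Longrightarrow> [x = u p] (mod p)" by auto
  have "m dvd (int x)\<^sup>2 - d"
  proof (rule squarefree_dvdI[OF m(2)])
    fix q :: int assume q: "prime q" "q dvd m"
    define p where "p = nat q"
    have p: "p \<in> ?Q" "q = int p"
      using q prime_ge_0_int[of q] by (auto simp: p_def)
    have "[(int x)\<^sup>2 = (int (u p))\<^sup>2] (mod int p)"
      using x[OF p(1)] by (intro cong_pow) (simp add: cong_int_iff)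
    then have "[(int x)\<^sup>2 = d] (mod int p)" using u[OF p(1)] cong_trans by blast
    then show "q dvd (int x)\<^sup>2 - d" by (simp add: p(2) cong_iff_dvd_diff)
  qed
  then show ?thesis by (auto simp: cong_iff_dvd_diff)
qed

text \<open>A difference that is not separated by any odd prime divisor is a square modulo \<open>m\<close> and therefore
zero; elements of the carrier are reduced, so they agree.\<close>

lemma separated_of_square_free_differences:
  assumes m: "m \<ge> 2" "squarefree m"
    and A: "A \<subseteq> carrier (residue_ring m)"
    and diff: "difference_set (residue_ring m) A \<inter> ring_squares (residue_ring m)
                 \<subseteq> {\<zero>\<^bsub>residue_ring m\<^esub>}"
  shows "separated (odd_prime_divisors m) A"
  unfolding separated_def
proof (intro ballI impI, rule ccontr)
  interpret residues m "residue_ring m" using m by unfold_locales auto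
  fix a b assume ab: "a \<in> A" "b \<in> A" "a \<noteq> b"
    and "\<not> (\<exists>p\<in>odd_prime_divisors m. Legendre (a - b) (int p) = -1)"
  then obtain y where y: "[y\<^sup>2 = a - b] (mod m)"
    using square_mod_squarefree[of m "a - b"] m by auto
  let ?d = "(a - b) mod m"
  have "a \<ominus>\<^bsub>residue_ring m\<^esub> b = ?d"
    by (simp add: a_minus_def res_neg_eq res_add_eq mod_simps)
  then have "?d \<in> difference_set (residue_ring m) A"
    unfolding difference_set_def mem_Collect_eq using ab(1,2)
    by (intro exI[of _ a] exI[of _ b]) simp
  moreover have "?d \<in> ring_squares (residue_ring m)"
  proof -
    have "?d = (y mod m) [^]\<^bsub>residue_ring m\<^esub> (2::nat)"
      using y m by (simp add: numeral_2_eq_2 res_mult_eq res_one_eq mod_simps cong_def power2_eq_square)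
    moreover have "?d \<in> carrier (residue_ring m)" "y mod m \<in> carrier (residue_ring m)"
      using m by (simp_all add: res_carrier_eq)
    ultimately show ?thesis unfolding ring_squares_def by blast
  qed
  ultimately have "?d = 0" using diff by (auto simp: res_zero_eq)
  then have "m dvd a - b" by auto
  moreover have "\<bar>a - b\<bar> < m"
  proof -
    have "a \<in> {0..m - 1}" "b \<in> {0..m - 1}" using ab(1,2) A unfolding res_carrier_eq by auto
    then show ?thesis by auto
  qed
  ultimately show False using ab(3) dvd_imp_le_int[of "a - b" m] by auto
qed

lemma odd_primes_divisors:
  assumes "m > 0"
  shows "odd_primes (odd_prime_divisors m)"
proof (rule odd_primes.intro)
  show "finite (odd_prime_divisors m)"
    using finite_prime_divisors[OF assms] by (rule rev_finite_subset) (auto simp: odd_prime_divisors_def)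
next
  fix p assume "p \<in> odd_prime_divisors m"
  then have "prime p" "p \<noteq> 2" by (auto simp: odd_prime_divisors_def)
  then show "odd_prime p"
    using prime_ge_2_nat[of p] by (intro odd_prime.intro) simp_all
qed

lemma prod_odd_prime_divisors_le:
  assumes "m > 0"
  shows "real (\<Prod>(odd_prime_divisors m)) \<le> real_of_int m"
proof -
  interpret odd_primes "odd_prime_divisors m" using assms by (rule odd_primes_divisors)
  let ?P = "odd_prime_divisors m"
  have "\<Prod>?P dvd nat m"
  proof (rule squarefree_dvdI)
    show "squarefree (\<Prod>?P)"
    proof (rule squarefree_prod_coprime)
      fix p q assume "p \<in> ?P" "q \<in> ?P" "p \<noteq> q"
      then show "coprime p q" by (intro primes_coprime) (simp_all add: odd_prime_divisors_def)
    next
      fix p assume "p \<in> ?P"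
      then show "squarefree p" by (intro squarefree_prime) (simp add: odd_prime_divisors_def)
    qed
    fix q :: nat assume "prime q" "q dvd \<Prod>?P"
    then obtain p where "p \<in> ?P" "q dvd p"
      using finite_P by (auto simp: prime_dvd_prod_iff)
    then have p: "prime p" "int p dvd m" by (auto simp: odd_prime_divisors_def)
    have "q = p" using \<open>prime q\<close> p(1) \<open>q dvd p\<close> by (rule primes_dvd_imp_eq)
    moreover have "int p dvd int (nat m)" using p(2) assms by simp
    ultimately show "q dvd nat m" by (simp only: int_dvd_int_iff)
  qed
  then have "\<Prod>?P \<le> nat m" using assms by (intro dvd_imp_le) auto
  then show ?thesis using assms by linarith
qed

section \<open>Comparing the two bounds\<close>

text \<open>The ratio of \<open>(p + 1) / 2\<close> to \<open>p\<close> is largest at \<open>p = 3\<close>, where it equals \<open>2/3\<close>.\<close>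

lemma (in odd_primes) card_separated_le_power:
  assumes "finite A" "separated P A"
  shows "real (card A) \<le> (2 / 3) ^ card P * real (\<Prod>P)"
proof -
  have "real (card A) \<le> real (\<Prod>p\<in>P. (p + 1) div 2)"
    using card_separated_le_rank[OF assms] by (simp only: of_nat_le_iff)
  also have "\<dots> \<le> (\<Prod>p\<in>P. (2 / 3) * real p)"
    unfolding of_nat_prod
  proof (intro prod_mono conjI)
    fix p assume "p \<in> P"
    then have "p > 2" by (intro odd_prime.gt_2 odd_prime_P)
    then have "3 * ((p + 1) div 2) \<le> 2 * p" by linarith
    then show "real ((p + 1) div 2) \<le> (2 / 3) * real p" by linarith
  qed auto
  finally show ?thesis by (simp only: prod.distrib prod_constant of_nat_prod)
qed

lemma ln_3_gt_1: "ln (3 :: real) > 1"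
proof -
  have "exp 1 < (3 :: real)" using e_less_272 by simp
  then show ?thesis by (metis exp_gt_zero less_trans ln_exp ln_less_cancel_iff zero_less_numeral)
qed

text \<open>With \<open>L = ln m\<close>, the threshold is \<open>n = \<kappa> / 6 * L / ln L\<close>. The constant \<open>\<kappa> = ln (ln 3)\<close> is a positive lower
bound for \<open>ln L\<close> on the whole range \<open>m \<ge> 3\<close>; taking the threshold proportional to it makes
\<open>3 n \<le> L\<close> below the threshold, so that \<open>(3 n)^n \<le> L^n \<le> exp (L / 6)\<close>.\<close>

lemma (in odd_primes) card_separated_le:
  assumes m: "m \<ge> 3" "real (\<Prod>P) \<le> m"
    and A: "finite A" "separated P A"
  shows "real (card A) \<le> m * exp (- (ln (ln 3) / 18) * ln m / ln (ln m))"
proof -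
  define n where "n = card P"
  define L where "L = ln m"
  define \<kappa> where "\<kappa> = ln (ln (3 :: real))"
  have ln3: "ln (3 :: real) > 1" by (rule ln_3_gt_1)
  then have \<kappa>0: "\<kappa> > 0" by (simp add: \<kappa>_def)
  have \<kappa>1: "\<kappa> \<le> 1"
    using ln_le_minus_one[of "3::real"] ln_le_minus_one[of "ln (3::real)"] ln3 by (simp add: \<kappa>_def)
  have "ln 3 \<le> L" using m(1) by (simp add: L_def)
  then have L: "L > 1" "ln L \<ge> \<kappa>" using ln3 by (auto simp: \<kappa>_def)
  have mexp: "m = exp L" using m(1) by (simp add: L_def)
  define Q where "Q = \<kappa> * (L / ln L)"
  have frac: "Q \<le> L"
    unfolding Q_def using L \<kappa>0 by (simp add: field_simps mult_right_mono)
  have Q18: "- (\<kappa> / 18) * L / ln L = - (Q / 18)" by (simp add: Q_def)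
  have "real (card A) \<le> m * exp (- (\<kappa> / 18) * ln m / ln (ln m))"
  proof (cases "real n \<ge> Q / 6")
    case True
    have "ln (2 / 3 :: real) \<le> - (1 / 3)" using ln_le_minus_one[of "2 / 3 :: real"] by simp
    then have "real n * ln (2 / 3) \<le> real n * (- (1 / 3))" by (intro mult_left_mono) auto
    also have "\<dots> \<le> - (\<kappa> / 18) * L / ln L" unfolding Q18 using True by simp
    finally have "(2 / 3 :: real) ^ n \<le> exp (- (\<kappa> / 18) * L / ln L)"
      by (simp add: powr_realpow[symmetric] powr_def)
    then have "(2 / 3) ^ n * real (\<Prod>P) \<le> exp (- (\<kappa> / 18) * L / ln L) * m"
      using m(2) by (intro mult_mono prod_nonneg of_nat_0_le_iff less_imp_le[OF exp_gt_zero])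
    then show ?thesis
      using card_separated_le_power[OF A] by (simp add: n_def L_def mult.commute)
  next
    case False
    then have n: "real n \<le> Q / 6" by simp
    have "3 * real n \<le> L" using n frac L(1) by linarith
    then have "(3 * real n) ^ n \<le> L ^ n" by (intro power_mono) auto
    also have "L ^ n = exp (real n * ln L)"
      using L by (simp add: powr_realpow[symmetric] powr_def)
    also have "real n * ln L \<le> Q / 6 * ln L"
      using L \<kappa>0 by (intro mult_right_mono n) auto
    also have "\<dots> = \<kappa> / 6 * L" unfolding Q_def using L \<kappa>0 by simp
    also have "\<dots> \<le> 1 / 6 * L" using \<kappa>1 L by (intro mult_right_mono) auto
    finally have pow: "(3 * real n) ^ n \<le> exp (1 / 6 * L)" by simp
    have "sqrt (real (\<Prod>P)) \<le> sqrt m" using m by simp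
    also have "sqrt m = exp (L / 2)"
      by (rule real_sqrt_unique) (auto simp: mexp simp flip: exp_double)
    finally have "(3 * real n) ^ n * sqrt (real (\<Prod>P)) \<le> exp (1 / 6 * L) * exp (L / 2)"
      using pow by (intro mult_mono) (auto intro: prod_nonneg)
    also have "\<dots> = exp (1 / 6 * L + L / 2)" by (simp only: exp_add)
    also have "\<dots> \<le> exp (L + - (\<kappa> / 18) * L / ln L)"
      unfolding Q18 using frac L(1) by simp
    also have "\<dots> = m * exp (- (\<kappa> / 18) * L / ln L)" by (simp only: exp_add mexp)
    finally show ?thesis
      using card_separated_le_spectral[OF A] unfolding n_def L_def by linarith
  qed
  then show ?thesis by (simp only: \<kappa>_def)
qed

theorem corollary2:
  "\<exists>c::real. c > 0 \<and>
     (\<forall>m::int. \<forall>A::int set.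
        m \<ge> 2 \<longrightarrow> squarefree m \<longrightarrow> A \<subseteq> carrier (residue_ring m) \<longrightarrow>
        difference_set (residue_ring m) A \<inter> ring_squares (residue_ring m)
          \<subseteq> {\<zero>\<^bsub>residue_ring m\<^esub>} \<longrightarrow>
        real (card A) \<le> real_of_int m *
          exp (- c * ln (real_of_int m) / ln (ln (real_of_int m))))"
proof (intro exI[of _ "ln (ln 3) / 18"] conjI allI impI)
  show pos: "ln (ln 3) / 18 > (0 :: real)" using ln_3_gt_1 by simp
  fix m :: int and A :: "int set"
  assume m: "m \<ge> 2" "squarefree m"
    and A: "A \<subseteq> carrier (residue_ring m)"
    and diff: "difference_set (residue_ring m) A \<inter> ring_squares (residue_ring m)
                 \<subseteq> {\<zero>\<^bsub>residue_ring m\<^esub>}"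
  have A': "A \<subseteq> {0..m - 1}" using A by (simp add: residue_ring_def)
  then have fin: "finite A" by (rule finite_subset) simp
  show "real (card A) \<le> real_of_int m *
          exp (- (ln (ln 3) / 18) * ln (real_of_int m) / ln (ln (real_of_int m)))"
  proof (cases "m = 2")
    case True
    \<comment> \<open>As \<open>ln (ln 2)\<close> is negative, the claimed bound is at least \<open>m = 2\<close> here.\<close>
    have "ln (2 :: real) \<le> 1" using ln_le_minus_one[of "2 :: real"] by simp
    then have "ln (ln (2 :: real)) \<le> 0" by simp
    then have "- (ln (ln 3) / 18) * ln 2 / ln (ln (2::real)) \<ge> 0"
      using pos by (intro divide_nonpos_nonpos mult_nonpos_nonneg) auto
    then have e: "1 \<le> exp (- (ln (ln 3) / 18) * ln 2 / ln (ln (2::real)))" by (simp only: one_le_exp_iff)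
    have "card A \<le> 2" using card_mono[OF _ A'] True by simp
    then have "real (card A) \<le> 2 * 1" by simp
    also have "\<dots> \<le> 2 * exp (- (ln (ln 3) / 18) * ln 2 / ln (ln (2::real)))"
      by (rule mult_left_mono[OF e]) simp
    finally show ?thesis using True by (simp only: of_int_numeral)
  next
    case False
    interpret odd_primes "odd_prime_divisors m" using m by (intro odd_primes_divisors) simp
    show ?thesis
      by (rule card_separated_le[OF _ prod_odd_prime_divisors_le fin
            separated_of_square_free_differences[OF m A diff]])
         (use m False in auto)
  qed
qed

end
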